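(* Fix $\delta\in(0,1)$, $\theta\in(0,1)$ and $f\in\mathcal{F}_\delta$, and let $X_1,X_2,\dots$ be i.i.d. with density $g=\theta+(1-\theta)f$ on $[0,1]$. If the partition $I=(I_k)_{1\le k\le D}$ of $[0,1]$ into intervals is such that $\max_k|I_k|$ is small enough (i.e. there is $\eta>0$ such that the following holds for every finite partition with $\max_k|I_k|\le\eta$), then the estimator $\hat\theta_{I,n}=\min_{1\le k\le D}\frac{n_k}{n|I_k|}$ has the following properties: (i) $\hat\theta_{I,n}$ converges almost surely to $\theta$ as $n\to\infty$; (ii) $\hat\theta_{I,n}$ is $\sqrt n$-consistent, i.e. $\sqrt n(\hat\theta_{I,n}-\theta)=O_{\mathbb{P}}(1)$; (iii) $\limsup_{n\to\infty}\mathrm{Var}(\sqrt n\,\hat\theta_{I,n})<+\infty$.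
   Context: $\mathcal{F}_\delta$ is the set of continuous non-increasing probability densities $f:[0,1]\to\mathbb{R}^+$ that are positive on $[0,1-\delta)$ and vanish on $[1-\delta,1]$. It is also assumed throughout that $f\in\mathbb{L}^2([0,1])$. For a partition $I=(I_k)_{1\le k\le D}$ of $[0,1]$ into finitely many intervals of positive length (fixed, not depending on $n$), $|I_k|$ is the length of $I_k$ and $n_k=\mathrm{card}\{1\le i\le n: X_i\in I_k\}$. $O_{\mathbb{P}}(1)$ means bounded in probability. *)

theory Defs
  imports "HOL-Probability.Probability"
begin

(* Functions on [0,1] are total functions real => real of which only the
   values on {0..1} matter. *)
definition decreasing_densities :: "real \<Rightarrow> (real \<Rightarrow> real) set" where
  "decreasing_densities \<delta> =
    {f. continuous_on {0..1} f \<and>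
        antimono_on {0..1} f \<and>
        (\<forall>x\<in>{0..1}. 0 \<le> f x) \<and>
        (LINT x:{0..1}|lborel. f x) = 1 \<and>
        (\<forall>x\<in>{0..<1 - \<delta>}. 0 < f x) \<and>
        (\<forall>x\<in>{1 - \<delta>..1}. f x = 0)}"

(* Extended by 0 outside [0,1], so that it is a density with respect to
   Lebesgue measure on the whole line. *)
definition mixture_density :: "real \<Rightarrow> (real \<Rightarrow> real) \<Rightarrow> real \<Rightarrow> real" where
  "mixture_density \<theta> f x = indicator {0..1} x * (\<theta> + (1 - \<theta>) * f x)"

(* The cells are genuinely disjoint, and each may be open, closed or half-open. *)
definition interval_partition :: "nat \<Rightarrow> (nat \<Rightarrow> real set) \<Rightarrow> bool" where
  "interval_partition D I \<longleftrightarrow>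
    (\<forall>k\<in>{1..D}. is_interval (I k) \<and> 0 < measure lborel (I k)) \<and>
    disjoint_family_on I {1..D} \<and>
    (\<Union>k\<in>{1..D}. I k) = {0..1}"

definition mesh :: "nat \<Rightarrow> (nat \<Rightarrow> real set) \<Rightarrow> real" where
  "mesh D I = Max ((\<lambda>k. measure lborel (I k)) ` {1..D})"

definition cell_count :: "(nat \<Rightarrow> 'a \<Rightarrow> real) \<Rightarrow> nat \<Rightarrow> real set \<Rightarrow> 'a \<Rightarrow> nat" where
  "cell_count X n J \<omega> = card {i \<in> {1..n}. X i \<omega> \<in> J}"

definition theta_hat ::
  "nat \<Rightarrow> (nat \<Rightarrow> real set) \<Rightarrow> (nat \<Rightarrow> 'a \<Rightarrow> real) \<Rightarrow> nat \<Rightarrow> 'a \<Rightarrow> real" where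
  "theta_hat D I X n \<omega> =
    Min ((\<lambda>k. real (cell_count X n (I k) \<omega>) / (real n * measure lborel (I k))) ` {1..D})"

(* Measurability is part of the notion: measure M assigns 0 to
   non-measurable sets, which would make the bound vacuous. *)
definition bounded_in_probability :: "'a measure \<Rightarrow> (nat \<Rightarrow> 'a \<Rightarrow> real) \<Rightarrow> bool" where
  "bounded_in_probability M Y \<longleftrightarrow>
    (\<forall>n. Y n \<in> borel_measurable M) \<and>
    (\<forall>\<epsilon>>0. \<exists>C. \<forall>n. measure M {\<omega> \<in> space M. \<bar>Y n \<omega>\<bar> > C} \<le> \<epsilon>)"

end

theory Submission
  imports Defs
begin

text \<open>
  Write \<open>p\<^sub>k\<close> for the probability of the cell \<open>I\<^sub>k\<close>. Since \<open>g \<ge> \<theta>\<close>, every ratio \<open>p\<^sub>k / |I\<^sub>k|\<close> is at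
  least \<open>\<theta>\<close>. If the mesh is at most \<open>\<delta>\<close>, the cell containing 1 lies in \<open>[1 - \<delta>, 1]\<close>, where
  \<open>g = \<theta>\<close>, so \<open>\<theta>\<close> is the minimum of these ratios. A difference of two minima is bounded by one
  of the coordinate differences, so each claim reduces to the cell frequencies: Hoeffding's
  inequality with Borel--Cantelli gives the almost sure convergence, and the binomial variance
  bounds \<open>n E(\<theta>\<^sub>n - \<theta>)\<^sup>2\<close>, \<open>\<theta>\<^sub>n\<close> being the estimator, by the constant
  \<open>\<Sum>\<^sub>k p\<^sub>k (1 - p\<^sub>k) / |I\<^sub>k|\<^sup>2\<close>. This second moment also dominates the variance of \<open>\<surd>n \<theta>\<^sub>n\<close>.
\<close>

section \<open>General tools: minima, variances of independent sums, almost sure limits\<close>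

text \<open>At a minimiser of one function, the value of the other bounds that other function's
  minimum from above. The sign of the difference of the minima decides whose minimiser serves as
  \<open>k\<close>.\<close>

lemma abs_Min_diff_le:
  fixes f g :: "'b \<Rightarrow> real"
  assumes "finite S" "S \<noteq> {}"
  obtains k where "k \<in> S" "\<bar>Min (f ` S) - Min (g ` S)\<bar> \<le> \<bar>f k - g k\<bar>"
proof -
  have "\<exists>k\<in>S. Min (g ` S) - Min (f ` S) \<le> g k - f k" for f g :: "'b \<Rightarrow> real"
  proof -
    have "Min (f ` S) \<in> f ` S"
      using assms by (intro Min_in) auto
    then obtain k where "k \<in> S" "Min (f ` S) = f k" by auto
    moreover have "Min (g ` S) \<le> g k"
      using assms \<open>k \<in> S\<close> by auto
    ultimately show ?thesis by force
  qed
  from this[of g f] this[of f g] show ?thesis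
    using that by (smt (verit))
qed

text \<open>After centring, the square of the sum expands into products \<open>Z i * Z j\<close>.
  Independence factors the expectation of each off-diagonal product into two zero means, so only the
  diagonal survives.\<close>

lemma (in prob_space) variance_sum_indep:
  fixes X :: "'i \<Rightarrow> 'a \<Rightarrow> real"
  assumes fin: "finite A" and indep: "indep_vars (\<lambda>_. borel) X A"
    and sq: "\<And>i. i \<in> A \<Longrightarrow> integrable M (\<lambda>\<omega>. (X i \<omega>)\<^sup>2)"
  shows "variance (\<lambda>\<omega>. \<Sum>i\<in>A. X i \<omega>) = (\<Sum>i\<in>A. variance (X i))"
proof -
  have rv: "random_variable borel (X i)" if "i \<in> A" for i
    using indep that by (auto simp: indep_vars_def)
  have int: "integrable M (X i)" if "i \<in> A" for i
    using square_integrable_imp_integrable[OF rv sq] that by blast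
  define Z where "Z i \<omega> = X i \<omega> - expectation (X i)" for i \<omega>
  have indepZ: "indep_vars (\<lambda>_. borel) Z A"
    unfolding Z_def by (rule indep_vars_compose2[OF indep]) simp
  have intZ: "integrable M (Z i)" and Z0: "expectation (Z i) = 0" if "i \<in> A" for i
    using int[OF that] by (simp_all add: Z_def[abs_def] prob_space)
  have sqZ: "integrable M (\<lambda>\<omega>. Z i \<omega> * Z i \<omega>)" if "i \<in> A" for i
    using sq[OF that] int[OF that] by (simp add: Z_def algebra_simps power2_eq_square)
  \<comment> \<open>Pairwise independence comes from independence of \<open>Z i\<close> and a sum of
    other variables, with the singleton \<open>{j}\<close> as index set of the sum.\<close>
  have indep2: "indep_var borel (Z i) borel (Z j)" if "i \<in> A" "j \<in> A" "i \<noteq> j" for i j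
    using indep_vars_sum[of "{j}" i, OF _ _ indep_vars_subset[OF indepZ]] that by simp
  have prod: "integrable M (\<lambda>\<omega>. Z i \<omega> * Z j \<omega>)" if "i \<in> A" "j \<in> A" for i j
    using indep_var_integrable[OF indep2 intZ intZ] sqZ that by (cases "i = j") auto
  have cov: "expectation (\<lambda>\<omega>. Z i \<omega> * Z j \<omega>) = (if i = j then variance (X i) else 0)"
    if "i \<in> A" "j \<in> A" for i j
  proof (cases "i = j")
    case True
    then show ?thesis by (simp add: Z_def power2_eq_square)
  next
    case False
    then show ?thesis
      using indep_var_lebesgue_integral[OF indep2 intZ intZ, of i j] Z0 that by simp
  qed
  have "variance (\<lambda>\<omega>. \<Sum>i\<in>A. X i \<omega>) = expectation (\<lambda>\<omega>. (\<Sum>i\<in>A. Z i \<omega>)\<^sup>2)"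
    using int by (simp add: Z_def sum_subtractf)
  also have "\<dots> = (\<Sum>i\<in>A. \<Sum>j\<in>A. expectation (\<lambda>\<omega>. Z i \<omega> * Z j \<omega>))"
    using prod by (simp add: power2_eq_square sum_product)
  also have "\<dots> = (\<Sum>i\<in>A. variance (X i))"
    using fin by (simp add: cov)
  finally show ?thesis .
qed

text \<open>The exceptional null set may depend on the tolerance. Restricting to the countably many
  tolerances \<open>1 / real (Suc m)\<close> gives one null set that works for all of them.\<close>

lemma (in prob_space) AE_tendstoI:
  fixes Y :: "nat \<Rightarrow> 'a \<Rightarrow> real"
  assumes "\<And>\<epsilon>. \<epsilon> > 0 \<Longrightarrow> AE \<omega> in M. \<forall>\<^sub>F n in sequentially. \<bar>Y n \<omega> - c\<bar> < \<epsilon>"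
  shows "AE \<omega> in M. (\<lambda>n. Y n \<omega>) \<longlonglongrightarrow> c"
proof -
  have "AE \<omega> in M. \<forall>m. \<forall>\<^sub>F n in sequentially. \<bar>Y n \<omega> - c\<bar> < 1 / real (Suc m)"
    unfolding AE_all_countable using assms by simp
  then show ?thesis
  proof eventually_elim
    case (elim \<omega>)
    show ?case
    proof (rule tendstoI)
      fix e :: real
      assume "e > 0"
      then obtain m where "1 / real (Suc m) < e"
        using nat_approx_posE by blast
      then show "\<forall>\<^sub>F n in sequentially. dist (Y n \<omega>) c < e"
        unfolding dist_real_def
        by (intro eventually_mono[OF spec[OF elim, of m]]) (erule less_trans)
    qed
  qed
qed

section \<open>Counts and frequencies of a single cell\<close>

lemma cell_count_eq_sum:
  "real (cell_count X n J \<omega>) = (\<Sum>i\<in>{1..n}. indicator J (X i \<omega>))"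
  unfolding cell_count_def by (simp add: indicator_def sum.If_cases Int_def)

context prob_space
begin

context
  fixes X :: "nat \<Rightarrow> 'a \<Rightarrow> real" and J :: "real set" and p :: real
  assumes indep: "indep_vars (\<lambda>_. borel) X {1..}"
    and J [measurable]: "J \<in> sets borel"
    and p: "\<And>i. i \<ge> 1 \<Longrightarrow> prob {\<omega> \<in> space M. X i \<omega> \<in> J} = p"
begin

lemma measurable_sample: "i \<ge> 1 \<Longrightarrow> random_variable borel (X i)"
  using indep by (auto simp: indep_vars_def)

lemma measurable_cell_count [measurable]:
  "(\<lambda>\<omega>. real (cell_count X n J \<omega>)) \<in> borel_measurable M"
  unfolding cell_count_eq_sum
  by (intro borel_measurable_sum measurable_compose[OF measurable_sample]) auto

lemma indep_vars_cell_indicator: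
  "indep_vars (\<lambda>_. borel) (\<lambda>i \<omega>. indicator J (X i \<omega>) :: real) {1..n}"
  by (rule indep_vars_compose2[OF indep_vars_subset[OF indep]]) auto

lemma expectation_cell_indicator:
  assumes "i \<ge> 1"
  shows "expectation (\<lambda>\<omega>. indicator J (X i \<omega>)) = p"
proof -
  note [measurable] = measurable_sample[OF assms]
  have "expectation (\<lambda>\<omega>. indicator J (X i \<omega>)) =
      expectation (indicator {\<omega> \<in> space M. X i \<omega> \<in> J})"
    by (intro Bochner_Integration.integral_cong) (auto simp: indicator_def)
  also have "\<dots> = p"
    using p[OF assms] by simp
  finally show ?thesis .
qed

lemma integrable_cell_indicator:
  assumes "i \<ge> 1"
  shows "integrable M (\<lambda>\<omega>. indicator J (X i \<omega>) :: real)"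
  by (rule integrable_const_bound[where B = 1])
     (auto intro!: measurable_compose[OF measurable_sample[OF assms]])

lemma expectation_cell_count: "expectation (\<lambda>\<omega>. real (cell_count X n J \<omega>)) = n * p"
  unfolding cell_count_eq_sum
  by (subst Bochner_Integration.integral_sum)
     (auto simp: expectation_cell_indicator intro: integrable_cell_indicator)

text \<open>An indicator equals its own square, so each summand has the Bernoulli variance
  \<open>p * (1 - p)\<close>, and independence adds these up.\<close>

lemma variance_cell_count: "variance (\<lambda>\<omega>. real (cell_count X n J \<omega>)) = n * (p * (1 - p))"
proof -
  have sq: "(indicator J x :: real)\<^sup>2 = indicator J x" for x
    by (simp add: indicator_def)
  have "variance (\<lambda>\<omega>. indicator J (X i \<omega>) :: real) = p * (1 - p)" if "i \<ge> 1" for i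
    using that by (subst variance_eq)
      (simp_all add: sq expectation_cell_indicator integrable_cell_indicator, simp add: algebra_simps power2_eq_square)
  then show ?thesis
    unfolding cell_count_eq_sum
    by (subst variance_sum_indep[OF _ indep_vars_cell_indicator])
       (auto simp: sq integrable_cell_indicator)
qed

text \<open>For a fixed tolerance the deviation probabilities decay geometrically and are therefore
  summable, so almost surely only finitely many deviations occur.\<close>

lemma AE_cell_frequency_tendsto:
  "AE \<omega> in M. (\<lambda>n. real (cell_count X n J \<omega>) / n) \<longlonglongrightarrow> p"
proof (rule AE_tendstoI)
  fix \<epsilon> :: real
  assume "\<epsilon> > 0"
  \<comment> \<open>For \<open>n\<close> summands with values in [0,1], Hoeffding bounds a deviation
    of size \<open>n * \<epsilon>\<close> by
    \<open>2 * exp (- 2 * (n * \<epsilon>)\<^sup>2 / n)\<close>, which is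
    \<open>2 * q ^ n\<close>.\<close>
  define q where "q = exp (- 2 * \<epsilon>\<^sup>2)"
  have q: "0 < q" "q < 1"
    using \<open>\<epsilon> > 0\<close> by (auto simp: q_def)
  define B where "B n = {\<omega> \<in> space M. \<bar>real (cell_count X n J \<omega>) - n * p\<bar> \<ge> n * \<epsilon>}" for n :: nat
  have B: "B n \<in> sets M" for n
    unfolding B_def by measurable
  have bound: "prob (B n) \<le> 2 * q ^ n" for n
  \<comment> \<open>For \<open>n = 0\<close> the event is all of \<open>space M\<close> and the
    bound is 2; Hoeffding is applied only to a nonempty sample.\<close>
  proof (cases "n = 0")
    case True
    then show ?thesis
      by (simp add: order_trans[OF prob_le_1])
  next
    case False
    \<comment> \<open>A meta-equality is the form in which \<open>Hoeffding_ineq\<close> takes its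
      mean parameter.\<close>
    have mean: "n * p \<equiv> (\<Sum>i\<in>{1..n}. expectation (\<lambda>\<omega>. indicator J (X i \<omega>)))"
      by (rule eq_reflection) (simp add: expectation_cell_indicator)
    interpret Hoeffding_ineq M "{1..n}" "\<lambda>i \<omega>. indicator J (X i \<omega>)" "\<lambda>_. 0" "\<lambda>_. 1" "n * p"
      by unfold_locales (use indep_vars_cell_indicator mean in \<open>auto simp: indicator_def\<close>)
    have "prob (B n) \<le> 2 * exp (- 2 * (n * \<epsilon>)\<^sup>2 / n)"
      using Hoeffding_ineq_abs_ge[of "n * \<epsilon>"] \<open>\<epsilon> > 0\<close> False
      by (simp add: B_def cell_count_eq_sum)
    also have "- 2 * (n * \<epsilon>)\<^sup>2 / n = n * (- 2 * \<epsilon>\<^sup>2)"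
      using False by (simp add: power2_eq_square)
    finally show ?thesis
      by (simp only: q_def exp_of_nat_mult)
  qed
  have "AE \<omega> in M. \<forall>\<^sub>F n in sequentially. \<omega> \<in> space M - B n"
  proof (rule borel_cantelli_AE1[OF B])
    show "summable (\<lambda>n. prob (B n))"
    proof (rule summable_comparison_test')
      show "summable (\<lambda>n. 2 * q ^ n)"
        using q by (intro summable_mult summable_geometric) simp
      show "norm (prob (B n)) \<le> 2 * q ^ n" if "n \<ge> 0" for n
        using bound by simp
    qed
  qed (simp add: emeasure_eq_measure)
  then show "AE \<omega> in M. \<forall>\<^sub>F n in sequentially. \<bar>real (cell_count X n J \<omega>) / n - p\<bar> < \<epsilon>"
  proof eventually_elim
    case (elim \<omega>)
    from elim eventually_gt_at_top[of 0] show ?case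
    proof eventually_elim
      case (elim n)
      then have "\<bar>real (cell_count X n J \<omega>) - n * p\<bar> < n * \<epsilon>"
        by (auto simp: B_def)
      moreover have "real (cell_count X n J \<omega>) / n - p = (real (cell_count X n J \<omega>) - n * p) / n"
        using elim by (simp add: field_simps)
      ultimately show ?case
        using elim by (simp add: abs_divide pos_divide_less_eq mult.commute)
    qed
  qed
qed

end

section \<open>The estimator on a fixed partition, with the sample law entering only through the
  cell probabilities\<close>

context
  fixes X :: "nat \<Rightarrow> 'a \<Rightarrow> real" and D :: nat and I :: "nat \<Rightarrow> real set"
    and p :: "nat \<Rightarrow> real" and \<theta> :: real
  assumes indep: "indep_vars (\<lambda>_. borel) X {1..}"
    and D: "D \<ge> 1"
    and I: "\<And>k. k \<in> {1..D} \<Longrightarrow> I k \<in> sets borel"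
    and L: "\<And>k. k \<in> {1..D} \<Longrightarrow> 0 < measure lborel (I k)"
    and p: "\<And>i k. i \<ge> 1 \<Longrightarrow> k \<in> {1..D} \<Longrightarrow> prob {\<omega> \<in> space M. X i \<omega> \<in> I k} = p k"
    and \<theta>: "\<theta> = Min ((\<lambda>k. p k / measure lborel (I k)) ` {1..D})"
begin

text \<open>The index \<open>k\<close> depends on \<open>n\<close> and \<open>\<omega>\<close>, so
  both later uses enlarge the bound to a sum over all cells.\<close>

lemma theta_hat_diff_le:
  obtains k where "k \<in> {1..D}" "\<bar>theta_hat D I X n \<omega> - \<theta>\<bar> \<le>
    \<bar>real (cell_count X n (I k) \<omega>) / (n * measure lborel (I k)) - p k / measure lborel (I k)\<bar>"
proof -
  have "{1..D} \<noteq> {}"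
    using D by simp
  then show ?thesis
    unfolding theta_hat_def \<theta>
    by (rule abs_Min_diff_le[OF finite_atLeastAtMost]) (rule that[unfolded theta_hat_def \<theta>])
qed

lemma measurable_theta_hat: "theta_hat D I X n \<in> borel_measurable M"
proof -
  have "(\<lambda>\<omega>. real (cell_count X n (I k) \<omega>)) \<in> borel_measurable M" if "k \<in> {1..D}" for k
    using measurable_cell_count[OF indep I[OF that] p[OF _ that]] .
  then show ?thesis
    unfolding theta_hat_def[abs_def]
    by (intro borel_measurable_Min[OF finite_atLeastAtMost] borel_measurable_divide
        borel_measurable_const)
qed

text \<open>Outside one null set all \<open>D\<close> frequencies converge at once. The error is
  then squeezed by a finite sum of null sequences.\<close>

lemma AE_theta_hat_tendsto: "AE \<omega> in M. (\<lambda>n. theta_hat D I X n \<omega>) \<longlonglongrightarrow> \<theta>"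
proof -
  have "AE \<omega> in M. \<forall>k\<in>{1..D}. (\<lambda>n. real (cell_count X n (I k) \<omega>) / n) \<longlonglongrightarrow> p k"
    by (rule AE_finite_allI) (simp, rule AE_cell_frequency_tendsto[OF indep I p])
  then show ?thesis
  proof eventually_elim
    case (elim \<omega>)
    define d where "d n k = \<bar>real (cell_count X n (I k) \<omega>) / (n * measure lborel (I k)) -
      p k / measure lborel (I k)\<bar>" for n k
    have d0: "(\<lambda>n. d n k) \<longlonglongrightarrow> 0" if "k \<in> {1..D}" for k
    proof -
      have "(\<lambda>n. real (cell_count X n (I k) \<omega>) / n / measure lborel (I k)) \<longlonglongrightarrow> p k / measure lborel (I k)"
        using L[OF that] by (intro tendsto_divide[OF bspec[OF elim that] tendsto_const]) simp
      from tendsto_rabs_zero[OF LIM_zero[OF this]] show ?thesis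
        by (simp add: d_def)
    qed
    have sum0: "(\<lambda>n. \<Sum>k\<in>{1..D}. d n k) \<longlonglongrightarrow> 0"
      using d0 by (rule tendsto_null_sum)
    have le: "norm (theta_hat D I X n \<omega> - \<theta>) \<le> (\<Sum>k\<in>{1..D}. d n k)" for n
    proof -
      obtain k where "k \<in> {1..D}" "\<bar>theta_hat D I X n \<omega> - \<theta>\<bar> \<le> d n k"
        unfolding d_def by (rule theta_hat_diff_le[of n \<omega>])
      moreover have "d n k \<le> (\<Sum>k\<in>{1..D}. d n k)"
        using \<open>k \<in> {1..D}\<close> by (intro member_le_sum) (auto simp: d_def)
      ultimately show ?thesis by simp
    qed
    have "(\<lambda>n. theta_hat D I X n \<omega> - \<theta>) \<longlonglongrightarrow> 0"
      by (rule Lim_null_comparison[OF always_eventually[OF allI[OF le]] sum0])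
    then show ?case
      by (rule LIM_zero_cancel)
  qed
qed

text \<open>The bound is free of \<open>n\<close>: the factor \<open>n\<close> in
  \<open>(W n \<omega>)\<^sup>2\<close> cancels the decay of the variance of a cell frequency. Both
  claims about the scaling by the root of \<open>n\<close> rest on it.\<close>

lemma theta_hat_second_moment:
  defines "W \<equiv> \<lambda>n \<omega>. sqrt (real n) * (theta_hat D I X n \<omega> - \<theta>)"
  shows "integrable M (\<lambda>\<omega>. (W n \<omega>)\<^sup>2)"
    and "expectation (\<lambda>\<omega>. (W n \<omega>)\<^sup>2) \<le> (\<Sum>k\<in>{1..D}. p k * (1 - p k) / (measure lborel (I k))\<^sup>2)"
proof -
  define N where "N k \<omega> = real (cell_count X n (I k) \<omega>)" for k \<omega>
  \<comment> \<open>This is \<open>n\<close> times the squared error of the ratio for cell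
    \<open>k\<close>, with fractions cleared. Division by zero makes it 0 for \<open>n = 0\<close>,
    in agreement with \<open>W\<close>.\<close>
  define U where "U k \<omega> = (N k \<omega> - n * p k)\<^sup>2 / (n * (measure lborel (I k))\<^sup>2)" for k \<omega>
  have p01: "0 \<le> p k" "p k \<le> 1" if "k \<in> {1..D}" for k
    using p[OF order_refl that] by (metis measure_nonneg, metis prob_le_1)
  have N: "N k \<in> borel_measurable M" if "k \<in> {1..D}" for k
    unfolding N_def[abs_def] using measurable_cell_count[OF indep I[OF that] p[OF _ that]] .
  \<comment> \<open>The crude bound by \<open>n\<close> serves integrability alone; the sharp
    estimate comes from the variance.\<close>
  have "0 \<le> N k \<omega>" "N k \<omega> \<le> n" for k \<omega>
    unfolding N_def cell_count_def by (auto intro: order_trans[OF card_mono[of "{1..n}"]])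
  then have bd: "\<bar>N k \<omega> - n * p k\<bar> \<le> n" if "k \<in> {1..D}" for k \<omega>
    using p01[OF that] mult_left_mono[of "p k" 1 "real n"] by (smt (verit) of_nat_0_le_iff mult_nonneg_nonneg)
  have intN: "integrable M (\<lambda>\<omega>. (N k \<omega> - n * p k)\<^sup>2)" if "k \<in> {1..D}" for k
    using N[OF that] power_mono[OF bd[OF that], where n = 2]
    by (intro integrable_const_bound[where B = "(real n)\<^sup>2"]) auto
  then have intU: "integrable M (U k)" if "k \<in> {1..D}" for k
    unfolding U_def[abs_def] using that by simp
  have EU: "expectation (U k) \<le> p k * (1 - p k) / (measure lborel (I k))\<^sup>2" if "k \<in> {1..D}" for k
  proof -
    have "expectation (\<lambda>\<omega>. (N k \<omega> - n * p k)\<^sup>2) = n * (p k * (1 - p k))"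
      using variance_cell_count[OF indep I[OF that] p[OF _ that], of n]
        expectation_cell_count[OF indep I[OF that] p[OF _ that], of n]
      by (simp add: N_def)
    then show ?thesis
      \<comment> \<open>Equality holds for \<open>n > 0\<close>. For \<open>n = 0\<close> the left
        side is 0, and the right side is nonnegative because \<open>p k\<close> lies in
        [0,1].\<close>
      using p01[OF that] by (cases "n = 0") (simp_all add: U_def[abs_def])
  qed
  have W_le: "(W n \<omega>)\<^sup>2 \<le> (\<Sum>k\<in>{1..D}. U k \<omega>)" for \<omega>
  proof -
    obtain k where k: "k \<in> {1..D}" and le: "\<bar>theta_hat D I X n \<omega> - \<theta>\<bar> \<le>
      \<bar>N k \<omega> / (n * measure lborel (I k)) - p k / measure lborel (I k)\<bar>"
      unfolding N_def by (rule theta_hat_diff_le[of n \<omega>])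
    have "(W n \<omega>)\<^sup>2 = n * \<bar>theta_hat D I X n \<omega> - \<theta>\<bar>\<^sup>2"
      by (simp add: W_def power_mult_distrib)
    also have "\<dots> \<le> n * \<bar>N k \<omega> / (n * measure lborel (I k)) - p k / measure lborel (I k)\<bar>\<^sup>2"
      using le by (intro mult_left_mono power_mono) auto
    also have "\<dots> = U k \<omega>"
    proof (cases "n = 0")
      case False
      then have "N k \<omega> / (n * measure lborel (I k)) - p k / measure lborel (I k) =
          (N k \<omega> - n * p k) / (n * measure lborel (I k))"
        using L[OF k] by (simp add: field_simps)
      then show ?thesis
        using False by (simp add: U_def power_divide power_mult_distrib power2_eq_square)
    qed (simp add: U_def)
    also have "\<dots> \<le> (\<Sum>k\<in>{1..D}. U k \<omega>)"
      using k by (intro member_le_sum) (auto simp: U_def)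
    finally show ?thesis .
  qed
  show intW: "integrable M (\<lambda>\<omega>. (W n \<omega>)\<^sup>2)"
  proof (rule Bochner_Integration.integrable_bound)
    show "integrable M (\<lambda>\<omega>. \<Sum>k\<in>{1..D}. U k \<omega>)"
      using intU by (rule Bochner_Integration.integrable_sum)
    show "(\<lambda>\<omega>. (W n \<omega>)\<^sup>2) \<in> borel_measurable M"
      using measurable_theta_hat[of n] by (simp add: W_def)
    show "AE \<omega> in M. norm ((W n \<omega>)\<^sup>2) \<le> norm (\<Sum>k\<in>{1..D}. U k \<omega>)"
      using W_le by (auto intro: order_trans[OF _ abs_ge_self])
  qed
  have "expectation (\<lambda>\<omega>. (W n \<omega>)\<^sup>2) \<le> expectation (\<lambda>\<omega>. \<Sum>k\<in>{1..D}. U k \<omega>)"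
    using intW intU W_le by (intro integral_mono) auto
  also have "\<dots> = (\<Sum>k\<in>{1..D}. expectation (U k))"
    using intU by (subst Bochner_Integration.integral_sum) auto
  also have "\<dots> \<le> (\<Sum>k\<in>{1..D}. p k * (1 - p k) / (measure lborel (I k))\<^sup>2)"
    using EU by (rule sum_mono)
  finally show "expectation (\<lambda>\<omega>. (W n \<omega>)\<^sup>2) \<le> \<dots>" .
qed

end

section \<open>Consequences of a uniform second moment bound\<close>

text \<open>By Chebyshev's inequality the tail beyond \<open>K\<close> has probability at most
  \<open>C / K\<^sup>2\<close>, uniformly in \<open>n\<close>.\<close>

lemma bounded_in_probability_second_moment:
  assumes Y: "\<And>n. Y n \<in> borel_measurable M"
    and sq: "\<And>n. integrable M (\<lambda>\<omega>. (Y n \<omega>)\<^sup>2)"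
    and C: "\<And>n. expectation (\<lambda>\<omega>. (Y n \<omega>)\<^sup>2) \<le> C"
  shows "bounded_in_probability M Y"
  unfolding bounded_in_probability_def
proof (intro conjI allI impI)
  fix \<epsilon> :: real
  assume "\<epsilon> > 0"
  have "C \<ge> 0"
    by (rule order_trans[OF Bochner_Integration.integral_nonneg C[of 0]]) simp
  \<comment> \<open>The square root gives \<open>C / K\<^sup>2 \<le> \<epsilon>\<close>; the added 1
    keeps \<open>K\<close> positive when \<open>C = 0\<close>.\<close>
  define K where "K = sqrt (C / \<epsilon>) + 1"
  have K: "K > 0"
    using \<open>C \<ge> 0\<close> \<open>\<epsilon> > 0\<close> by (simp add: K_def add_nonneg_pos)
  have "C / \<epsilon> = (sqrt (C / \<epsilon>))\<^sup>2"
    using \<open>C \<ge> 0\<close> \<open>\<epsilon> > 0\<close> by simp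
  also have "\<dots> \<le> K\<^sup>2"
    using \<open>C \<ge> 0\<close> \<open>\<epsilon> > 0\<close> by (intro power_mono) (auto simp: K_def)
  finally have CK: "C / K\<^sup>2 \<le> \<epsilon>"
    using K \<open>\<epsilon> > 0\<close> by (simp add: field_simps)
  have "prob {\<omega> \<in> space M. \<bar>Y n \<omega>\<bar> > K} \<le> \<epsilon>" for n
  proof -
    note [measurable] = Y
    have "prob {\<omega> \<in> space M. \<bar>Y n \<omega>\<bar> > K} \<le> prob {\<omega> \<in> space M. \<bar>Y n \<omega>\<bar> \<ge> K}"
      by (intro finite_measure_mono) auto
    also have "\<dots> \<le> expectation (\<lambda>\<omega>. (Y n \<omega>)\<^sup>2) / K\<^sup>2"
      using Y sq K by (rule second_moment_method)
    also have "\<dots> \<le> C / K\<^sup>2"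
      using C by (rule divide_right_mono) simp
    finally show ?thesis
      using CK by simp
  qed
  then show "\<exists>K. \<forall>n. prob {\<omega> \<in> space M. \<bar>Y n \<omega>\<bar> > K} \<le> \<epsilon>" by blast
qed (rule Y)

text \<open>Shifting by \<open>c\<close> leaves the variance unchanged, and a variance is a second
  moment minus a squared mean.\<close>

lemma variance_le_second_moment:
  fixes Y :: "'a \<Rightarrow> real"
  assumes "Y \<in> borel_measurable M" "integrable M (\<lambda>\<omega>. (Y \<omega> - c)\<^sup>2)"
  shows "variance Y \<le> expectation (\<lambda>\<omega>. (Y \<omega> - c)\<^sup>2)"
proof -
  have "(\<lambda>\<omega>. Y \<omega> - c) \<in> borel_measurable M"
    using assms(1) by simp
  then have int: "integrable M (\<lambda>\<omega>. Y \<omega> - c)"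
    using assms(2) by (rule square_integrable_imp_integrable)
  have "integrable M Y"
    using Bochner_Integration.integrable_add[OF int integrable_const[of c]] by simp
  then have mean: "expectation (\<lambda>\<omega>. Y \<omega> - c) = expectation Y - c"
    by (simp add: prob_space)
  have "variance Y = variance (\<lambda>\<omega>. Y \<omega> - c)"
    by (simp only: mean diff_diff_eq2 diff_add_cancel)
  also have "\<dots> \<le> expectation (\<lambda>\<omega>. (Y \<omega> - c)\<^sup>2)"
    unfolding variance_eq[OF int assms(2)] by simp
  finally show ?thesis .
qed

end

section \<open>Cell probabilities under the mixture density\<close>

text \<open>The right side does not mention \<open>X\<close>, so all observations give a cell the
  same probability.\<close>

lemma emeasure_mixture_cell:
  assumes X: "distributed M lborel X (\<lambda>x. ennreal (mixture_density \<theta> f x))"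
    and J: "J \<in> sets borel" "J \<subseteq> {0..1}"
  shows "emeasure M {\<omega> \<in> space M. X \<omega> \<in> J} =
    (\<integral>\<^sup>+x. ennreal (\<theta> + (1 - \<theta>) * f x) * indicator J x \<partial>lborel)"
proof -
  have "{\<omega> \<in> space M. X \<omega> \<in> J} = X -` J \<inter> space M"
    by auto
  then have "emeasure M {\<omega> \<in> space M. X \<omega> \<in> J} =
      (\<integral>\<^sup>+x. ennreal (mixture_density \<theta> f x) * indicator J x \<partial>lborel)"
    using distributed_emeasure[OF X, of J] J by simp
  also have "\<dots> = (\<integral>\<^sup>+x. ennreal (\<theta> + (1 - \<theta>) * f x) * indicator J x \<partial>lborel)"
    using J by (intro nn_integral_cong) (auto simp: mixture_density_def indicator_def)
  finally show ?thesis .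
qed

lemma nn_integral_const_cell:
  fixes J :: "real set"
  assumes "J \<in> sets borel" "J \<subseteq> {0..1}" "\<theta> \<ge> 0"
  shows "(\<integral>\<^sup>+x. ennreal \<theta> * indicator J x \<partial>lborel) = ennreal (\<theta> * measure lborel J)"
proof -
  have "emeasure lborel J < \<infinity>"
    using assms(2) by (intro emeasure_bounded_finite bounded_subset[OF bounded_closed_interval])
  then have "emeasure lborel J = ennreal (measure lborel J)"
    by (intro emeasure_eq_ennreal_measure) simp
  then show ?thesis
    using assms by (simp add: nn_integral_cmult_indicator ennreal_mult)
qed

text \<open>Both parts compare the density with the constant \<theta> on \<open>J\<close>. The
  inequality serves every cell, the equality the cell containing 1.\<close>

lemma (in prob_space)
  assumes X: "distributed M lborel X (\<lambda>x. ennreal (mixture_density \<theta> f x))"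
    and J: "J \<in> sets borel" "J \<subseteq> {0..1}"
    and \<theta>: "0 \<le> \<theta>" "\<theta> \<le> 1"
  shows prob_mixture_cell_ge:
      "(\<And>x. x \<in> J \<Longrightarrow> 0 \<le> f x) \<Longrightarrow> \<theta> * measure lborel J \<le> prob {\<omega> \<in> space M. X \<omega> \<in> J}"
    and prob_mixture_cell_eq:
      "(\<And>x. x \<in> J \<Longrightarrow> f x = 0) \<Longrightarrow> prob {\<omega> \<in> space M. X \<omega> \<in> J} = \<theta> * measure lborel J"
proof -
  let ?E = "{\<omega> \<in> space M. X \<omega> \<in> J}"
  have int: "ennreal (prob ?E) = (\<integral>\<^sup>+x. ennreal (\<theta> + (1 - \<theta>) * f x) * indicator J x \<partial>lborel)"
    using emeasure_mixture_cell[OF X J] by (simp add: emeasure_eq_measure)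
  {
    assume f: "\<And>x. x \<in> J \<Longrightarrow> 0 \<le> f x"
    have "ennreal (\<theta> * measure lborel J) \<le> ennreal (prob ?E)"
      unfolding int nn_integral_const_cell[OF J \<theta>(1), symmetric]
      using \<theta> f by (intro nn_integral_mono) (auto simp: indicator_def intro!: ennreal_leI)
    then show "\<theta> * measure lborel J \<le> prob ?E" by simp
  }
  {
    assume f: "\<And>x. x \<in> J \<Longrightarrow> f x = 0"
    have "ennreal (prob ?E) = ennreal (\<theta> * measure lborel J)"
      unfolding int nn_integral_const_cell[OF J \<theta>(1), symmetric]
      using f by (intro nn_integral_cong) (auto simp: indicator_def)
    then show "prob ?E = \<theta> * measure lborel J"
      using \<theta> by simp
  }
qed

text \<open>An interval containing \<open>x\<close> and 1 contains \<open>{x..1}\<close>, so its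
  length is at least \<open>1 - x\<close>.\<close>

lemma interval_subset_near_endpoint:
  fixes J :: "real set"
  assumes J: "is_interval J" "J \<subseteq> {0..1}" "1 \<in> J"
  shows "J \<subseteq> {1 - measure lborel J..1}"
proof
  fix x assume "x \<in> J"
  then have sub: "{x..1} \<subseteq> J"
    using J by (meson atLeastAtMost_iff is_interval_1 subsetI)
  have "emeasure lborel J < \<infinity>"
    using J(2) by (intro emeasure_bounded_finite bounded_subset[OF bounded_closed_interval])
  then have "J \<in> fmeasurable lborel"
    using real_interval_borel_measurable[OF J(1)] by (intro fmeasurableI) simp_all
  then have "measure lborel {x..1} \<le> measure lborel J"
    using sub by (intro measure_mono_fmeasurable) auto
  then show "x \<in> {1 - measure lborel J..1}"
    using \<open>x \<in> J\<close> J by auto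
qed

section \<open>Identification of \<theta> as the minimal ratio, and the three claims\<close>

theorem proposition2:
  fixes M :: "'a measure"
    and X :: "nat \<Rightarrow> 'a \<Rightarrow> real"
    and f :: "real \<Rightarrow> real"
    and \<delta> \<theta> :: real
  assumes "\<delta> \<in> {0<..<1}"
    and "\<theta> \<in> {0<..<1}"
    and "f \<in> decreasing_densities \<delta>"
    and "set_integrable lborel {0..1} (\<lambda>x. (f x)\<^sup>2)"
    and "prob_space M"
    and "prob_space.indep_vars M (\<lambda>_. borel) X {1..}"
    and "\<And>i. i \<ge> 1 \<Longrightarrow> distributed M lborel (X i) (\<lambda>x. ennreal (mixture_density \<theta> f x))"
  shows "\<exists>\<eta>>0. \<forall>D I. interval_partition D I \<and> mesh D I \<le> \<eta> \<longrightarrow>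
    (AE \<omega> in M. (\<lambda>n. theta_hat D I X n \<omega>) \<longlonglongrightarrow> \<theta>) \<and>
    bounded_in_probability M (\<lambda>n \<omega>. sqrt (real n) * (theta_hat D I X n \<omega> - \<theta>)) \<and>
    limsup (\<lambda>n. ereal (prob_space.variance M (\<lambda>\<omega>. sqrt (real n) * theta_hat D I X n \<omega>))) < \<infinity>"
proof (intro exI[of _ \<delta>] conjI allI impI; (elim conjE)?)
  \<comment> \<open>The threshold is \<delta>, the length of the stretch at the right end where
    \<open>f\<close> vanishes.\<close>
  show "\<delta> > 0" using assms(1) by simp
next
  interpret prob_space M by fact
  fix D I
  assume part: "interval_partition D I" and mesh: "mesh D I \<le> \<delta>"
  have ivl: "is_interval (I k)" and L: "0 < measure lborel (I k)" if "k \<in> {1..D}" for k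
    using part that by (auto simp: interval_partition_def)
  have Un: "(\<Union>k\<in>{1..D}. I k) = {0..1}"
    using part by (simp add: interval_partition_def)
  then have sub: "I k \<subseteq> {0..1}" if "k \<in> {1..D}" for k
    using that by blast
  have meas: "I k \<in> sets borel" if "k \<in> {1..D}" for k
    using ivl[OF that] by (rule real_interval_borel_measurable)
  have f0: "\<And>x. x \<in> {0..1} \<Longrightarrow> 0 \<le> f x" and f1: "\<And>x. x \<in> {1 - \<delta>..1} \<Longrightarrow> f x = 0"
    using assms(3) by (auto simp: decreasing_densities_def)
  \<comment> \<open>Since the cells cover [0,1], some cell contains 1; its existence also yields
    \<open>D \<ge> 1\<close>.\<close>
  obtain m where m: "m \<in> {1..D}" "1 \<in> I m"
    using Un by (metis UN_E atLeastAtMost_iff order_refl zero_le_one)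
  \<comment> \<open>The first observation stands for all of them, by the identical
    distribution.\<close>
  define p where "p k = prob {\<omega> \<in> space M. X 1 \<omega> \<in> I k}" for k
  have p: "prob {\<omega> \<in> space M. X i \<omega> \<in> I k} = p k" if "i \<ge> 1" "k \<in> {1..D}" for i k
    unfolding p_def measure_def
    using emeasure_mixture_cell[OF assms(7) meas sub, of _ k] that by simp
  have p_ge: "\<theta> \<le> p k / measure lborel (I k)" if "k \<in> {1..D}" for k
    using prob_mixture_cell_ge[OF assms(7)[OF order_refl] meas[OF that] sub[OF that]]
      f0 sub[OF that] assms(2) L[OF that]
    by (force simp: p_def field_simps)
  have "measure lborel (I m) \<le> mesh D I"
    unfolding mesh_def using m by (intro Max_ge) auto
  then have "I m \<subseteq> {1 - \<delta>..1}"
    using interval_subset_near_endpoint[OF ivl sub, of m] m mesh by fastforce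
  then have "p m = \<theta> * measure lborel (I m)"
    unfolding p_def using m assms(2) f1
    by (intro prob_mixture_cell_eq[OF assms(7) meas sub]) auto
  then have "\<theta> = p m / measure lborel (I m)"
    using L[OF m(1)] by simp
  then have \<theta>: "\<theta> = Min ((\<lambda>k. p k / measure lborel (I k)) ` {1..D})"
    using m p_ge by (intro Min_eqI[symmetric]) auto
  have D: "D \<ge> 1"
    using m by simp
  note setting = assms(6) D meas L p \<theta>
  note W = theta_hat_second_moment[OF setting]
  have W_meas: "(\<lambda>\<omega>. sqrt n * (theta_hat D I X n \<omega> - \<theta>)) \<in> borel_measurable M"
    and \<theta>_meas: "(\<lambda>\<omega>. sqrt n * theta_hat D I X n \<omega>) \<in> borel_measurable M" for n :: nat
    using measurable_theta_hat[OF setting, of n] by simp_all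
  show "AE \<omega> in M. (\<lambda>n. theta_hat D I X n \<omega>) \<longlonglongrightarrow> \<theta>"
    by (rule AE_theta_hat_tendsto[OF setting])
  show "bounded_in_probability M (\<lambda>n \<omega>. sqrt (real n) * (theta_hat D I X n \<omega> - \<theta>))"
    using W_meas W by (rule bounded_in_probability_second_moment)
  define C where "C = (\<Sum>k\<in>{1..D}. p k * (1 - p k) / (measure lborel (I k))\<^sup>2)"
  \<comment> \<open>Centring at \<open>sqrt n * \<theta>\<close> turns the second moment into that
    of \<open>W\<close>, already bounded by \<open>C\<close>.\<close>
  have "variance (\<lambda>\<omega>. sqrt (real n) * theta_hat D I X n \<omega>) \<le> C" for n
    using variance_le_second_moment[OF \<theta>_meas, of n "sqrt n * \<theta>"] W[of n]
    by (simp add: C_def right_diff_distrib)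
  then have "limsup (\<lambda>n. ereal (variance (\<lambda>\<omega>. sqrt (real n) * theta_hat D I X n \<omega>))) \<le> ereal C"
    by (intro Limsup_bounded) auto
  then show "limsup (\<lambda>n. ereal (variance (\<lambda>\<omega>. sqrt (real n) * theta_hat D I X n \<omega>))) < \<infinity>"
    by (rule order_le_less_trans) simp
qed

end
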